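(* Consider the first order finite volume scheme with explicit Euler step $$u_i^+ = u_i-\frac{\Delta t}{\Delta x}\Big(f^{\mathrm{num}}(u_i,u_{i+1})-f^{\mathrm{num}}(u_{i-1},u_i)\Big)$$ for the Euler equations of gas dynamics. Suppose that the numerical density flux can be written at each interface as $$f^{\mathrm{num}}_\rho(u_i,u_{i+1})=\overline\rho\cdot\frac{v_i+v_{i+1}}{2}-\frac{\lambda}{2}(\rho_{i+1}-\rho_i),$$ where $\lambda\ge\max\{|v_i|,|v_{i+1}|\}$ and $\overline\rho=\overline\rho(\rho_i,\rho_{i+1})$ is some mean value bounded by the arithmetic mean, i.e. $$\overline\rho(\rho_i,\rho_{i+1})\in\big[\min\{\rho_i,\rho_{i+1}\},\max\{\rho_i,\rho_{i+1}\}\big],\qquad \overline\rho(\rho_i,\rho_{i+1})\le\frac{\rho_i+\rho_{i+1}}{2}.$$ Then the scheme preserves the non-negativity of the density (if $\rho_j\ge0$ for all $j$, then $\rho_i^+\ge0$ for all $i$) under the CFL condition $$\Delta t\le\frac{\Delta x}{2\lambda}.$$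
   Context: Here $\rho_i$ and $v_i\in\mathbb{R}$ denote the density and the velocity in cell $i$, $\Delta x>0$ is the cell size, $\Delta t>0$ the time step, and $f^{\mathrm{num}}_\rho$ the density component of the numerical flux, so that $\rho_i^+=\rho_i-\frac{\Delta t}{\Delta x}\big(f^{\mathrm{num}}_\rho(u_i,u_{i+1})-f^{\mathrm{num}}_\rho(u_{i-1},u_i)\big)$. The value $\lambda$ may depend on the interface; the CFL condition (read as $2\lambda\Delta t\le\Delta x$) is required for the values of $\lambda$ at all interfaces. *)

theory Defs
  imports "HOL-Analysis.Finite_Cartesian_Product"
begin

text \<open>Conserved variables of the one-dimensional Euler equations: density, momentum density,
  total energy density. Numerical fluxes take values in the same space.\<close>

type_synonym euler_state = "real ^ 3"

definition rho :: "euler_state \<Rightarrow> real" where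
  "rho u = u $ 1"

definition momentum :: "euler_state \<Rightarrow> real" where
  "momentum u = u $ 2"

text \<open>A relation rather than the quotient of momentum and density, since the density may vanish;
  every real number is a velocity of a vacuum state with zero momentum.\<close>

definition is_velocity :: "euler_state \<Rightarrow> real \<Rightarrow> bool" where
  "is_velocity u v \<longleftrightarrow> momentum u = rho u * v"

definition fv_euler_step ::
  "real \<Rightarrow> real \<Rightarrow> (euler_state \<Rightarrow> euler_state \<Rightarrow> euler_state) \<Rightarrow> (int \<Rightarrow> euler_state) \<Rightarrow> int \<Rightarrow> euler_state"
  where
  "fv_euler_step \<Delta>t \<Delta>x fnum u i =
     u i - (\<Delta>t / \<Delta>x) *\<^sub>R (fnum (u i) (u (i + 1)) - fnum (u (i - 1)) (u i))"

definition density_flux ::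
  "(euler_state \<Rightarrow> euler_state \<Rightarrow> euler_state) \<Rightarrow> euler_state \<Rightarrow> euler_state \<Rightarrow> real" where
  "density_flux fnum ul ur = fnum ul ur $ 1"

end

theory Submission
  imports Defs
begin

text \<open>Through either interface the outflow from cell \<open>i\<close> is at most \<open>\<lambda> \<rho>\<^sub>i\<close>, with the \<open>\<lambda>\<close> of that
  interface; by the CFL condition each of the two losses is at most half of the mass of the cell.\<close>

lemma dissipative_flux_bounds:
  fixes a b m w l :: real
  assumes "0 \<le> m" "m \<le> (a + b) / 2" "\<bar>w\<bar> \<le> l"
  shows "m * w - l / 2 * (b - a) \<le> l * a"
    and "- (l * b) \<le> m * w - l / 2 * (b - a)"
proof -
  \<comment> \<open>The arithmetic mean is exactly the bound that the dissipation can absorb: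
    \<open>l * (a + b) / 2 - l / 2 * (b - a)\<close> collapses to \<open>l * a\<close>, and
    \<open>- l * (a + b) / 2 - l / 2 * (b - a)\<close> to \<open>- l * b\<close>, so the density of
    the receiving cell drops out of each bound.\<close>
  have "\<bar>m * w\<bar> \<le> (a + b) / 2 * l"
    unfolding abs_mult using assms by (intro mult_mono) auto
  then show "m * w - l / 2 * (b - a) \<le> l * a" "- (l * b) \<le> m * w - l / 2 * (b - a)"
    by (auto simp: abs_le_iff field_simps)
qed

lemma rho_fv_euler_step:
  "rho (fv_euler_step \<Delta>t \<Delta>x fnum u i) = rho (u i)
     - \<Delta>t / \<Delta>x * (density_flux fnum (u i) (u (i + 1)) - density_flux fnum (u (i - 1)) (u i))"
  by (simp add: rho_def fv_euler_step_def density_flux_def)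

theorem theorem6p1:
  fixes fnum :: "euler_state \<Rightarrow> euler_state \<Rightarrow> euler_state"
    and u :: "int \<Rightarrow> euler_state"
    and v :: "int \<Rightarrow> real"
    and lam :: "int \<Rightarrow> real"
    and rho_mean :: "real \<Rightarrow> real \<Rightarrow> real"
    and \<Delta>t \<Delta>x :: real
  assumes "\<Delta>x > 0" and "\<Delta>t > 0"
    and velocity: "\<And>i. is_velocity (u i) (v i)"
    and flux: "\<And>i. density_flux fnum (u i) (u (i + 1)) =
        rho_mean (rho (u i)) (rho (u (i + 1))) * ((v i + v (i + 1)) / 2)
        - lam i / 2 * (rho (u (i + 1)) - rho (u i))"
    and speed: "\<And>i. lam i \<ge> max \<bar>v i\<bar> \<bar>v (i + 1)\<bar>"
    and mean: "\<And>i. rho_mean (rho (u i)) (rho (u (i + 1)))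
        \<in> {min (rho (u i)) (rho (u (i + 1))) .. max (rho (u i)) (rho (u (i + 1)))}"
    and mean_le_arith: "\<And>i. rho_mean (rho (u i)) (rho (u (i + 1)))
        \<le> (rho (u i) + rho (u (i + 1))) / 2"
    and CFL: "\<And>i. 2 * lam i * \<Delta>t \<le> \<Delta>x"
  shows "(\<forall>j. rho (u j) \<ge> 0) \<longrightarrow> (\<forall>i. rho (fv_euler_step \<Delta>t \<Delta>x fnum u i) \<ge> 0)"
proof (intro impI allI)
  fix i
  assume nonneg: "\<forall>j. rho (u j) \<ge> 0"
  let ?F = "\<lambda>j. density_flux fnum (u j) (u (j + 1))"
  have F: "?F j \<le> lam j * rho (u j)" "- (lam j * rho (u (j + 1))) \<le> ?F j" for j
  proof -
    \<comment> \<open>Only the lower end of the interval in \<open>mean\<close> enters here: it is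
      the minimum of two nonnegative densities.\<close>
    have "0 \<le> rho_mean (rho (u j)) (rho (u (j + 1)))"
      using mean[of j] nonneg by (meson atLeastAtMost_iff min.boundedI order_trans)
    moreover have "\<bar>(v j + v (j + 1)) / 2\<bar> \<le> lam j"
      using speed[of j] by (auto simp: abs_le_iff)
    ultimately show "?F j \<le> lam j * rho (u j)" "- (lam j * rho (u (j + 1))) \<le> ?F j"
      unfolding flux using mean_le_arith[of j] dissipative_flux_bounds by blast+
  qed
  \<comment> \<open>Cell \<open>i\<close> lies to the left of interface \<open>i\<close> and to the
    right of interface \<open>i - 1\<close>. So \<open>F(1)\<close> at \<open>i\<close> and
    \<open>F(2)\<close> at \<open>i - 1\<close> both bound the loss by a multiple of
    \<open>rho (u i)\<close>, and no neighbouring density remains.\<close>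
  have "\<Delta>t / \<Delta>x * (?F i - density_flux fnum (u (i - 1)) (u i))
      \<le> \<Delta>t / \<Delta>x * ((lam i + lam (i - 1)) * rho (u i))"
    using F(1)[of i] F(2)[of "i - 1"] \<open>\<Delta>x > 0\<close> \<open>\<Delta>t > 0\<close>
    by (intro mult_left_mono) (auto simp: algebra_simps)
  also have "\<dots> = (\<Delta>t * (lam i + lam (i - 1)) / \<Delta>x) * rho (u i)"
    by simp
  \<comment> \<open>Adding the CFL conditions of the two interfaces and halving gives
    \<open>\<Delta>t * (lam i + lam (i - 1)) \<le> \<Delta>x\<close>; this is where the factor 2 is
    spent.\<close>
  also have "\<dots> \<le> 1 * rho (u i)"
    using CFL[of i] CFL[of "i - 1"] \<open>\<Delta>x > 0\<close> nonneg
    by (intro mult_right_mono) (auto simp: field_simps)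
  finally show "rho (fv_euler_step \<Delta>t \<Delta>x fnum u i) \<ge> 0"
    by (simp add: rho_fv_euler_step)
qed

end
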